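(* Let $R$ be a reduced ring and $\mathfrak{P}(R)=\prod_{\mathfrak{p}\in\mathrm{Min}\,R}R/\mathfrak{p}$, where $\mathrm{Min}\,R$ is the set of minimal prime ideals of $R$, with $R$ regarded as a subring of $\mathfrak{P}(R)$ via the canonical embedding. If for $a,b\in R$, $a\wedge_{\mathrm{rr}} b=0$ in $\mathfrak{P}(R)$ then $a\wedge_{\mathrm{rr}} b=0$ in $R$. In particular, if $ab=0$ then $a\wedge_{\mathrm{rr}} b=0$ in both rings.
   Context: All rings are unitary (not necessarily commutative) and reduced (no non-zero nilpotent elements). The reduced ring order (rr-order) on a reduced ring $R$ is the partial order $a\le_{\mathrm{rr}} b$ if and only if $ab=a^2$; $a\wedge_{\mathrm{rr}} b$ denotes the infimum of $a$ and $b$ in this order (in the ring indicated). For a minimal prime ideal $\mathfrak{p}$ of a reduced ring $R$, the ring $R/\mathfrak{p}$ is a domain, so $\mathfrak{P}(R)$ is a product of domains and is reduced. *)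

theory Defs
  imports "HOL-Algebra.Ideal_Product" "HOL-Algebra.QuotRing" "HOL-Algebra.Order"
begin

locale reduced_ring = ring +
  assumes reduced: "\<lbrakk>x \<in> carrier R; x [^] (n::nat) = \<zero>\<rbrakk> \<Longrightarrow> x = \<zero>"

(* The locale primeideal of HOL-Algebra presupposes a commutative ring. Here a proper two-sided
   ideal P is prime if I J \<subseteq> P implies I \<subseteq> P or J \<subseteq> P for all two-sided ideals I, J. *)
definition nc_prime_ideal :: "'a set \<Rightarrow> ('a, 'm) ring_scheme \<Rightarrow> bool" where
  "nc_prime_ideal P R \<longleftrightarrow>
     ideal P R \<and> P \<noteq> carrier R \<and>
     (\<forall>I J. ideal I R \<longrightarrow> ideal J R \<longrightarrow> ideal_prod R I J \<subseteq> P \<longrightarrow> I \<subseteq> P \<or> J \<subseteq> P)"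

definition Min_primes :: "('a, 'm) ring_scheme \<Rightarrow> 'a set set" where
  "Min_primes R = {P. nc_prime_ideal P R \<and> (\<forall>Q. nc_prime_ideal Q R \<longrightarrow> Q \<subseteq> P \<longrightarrow> Q = P)}"

definition product_ring :: "'i set \<Rightarrow> ('i \<Rightarrow> ('b, 'n) ring_scheme) \<Rightarrow> ('i \<Rightarrow> 'b) ring" where
  "product_ring I S =
     \<lparr>carrier = (\<Pi>\<^sub>E i\<in>I. carrier (S i)),
      mult = (\<lambda>x y. \<lambda>i\<in>I. x i \<otimes>\<^bsub>S i\<^esub> y i),
      one = (\<lambda>i\<in>I. \<one>\<^bsub>S i\<^esub>),
      zero = (\<lambda>i\<in>I. \<zero>\<^bsub>S i\<^esub>),
      add = (\<lambda>x y. \<lambda>i\<in>I. x i \<oplus>\<^bsub>S i\<^esub> y i)\<rparr>"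

definition PMin :: "('a, 'm) ring_scheme \<Rightarrow> ('a set \<Rightarrow> 'a set) ring" where
  "PMin R = product_ring (Min_primes R) (\<lambda>P. R Quot P)"

definition PMin_embed :: "('a, 'm) ring_scheme \<Rightarrow> 'a \<Rightarrow> ('a set \<Rightarrow> 'a set)" where
  "PMin_embed R a = (\<lambda>P\<in>Min_primes R. P +>\<^bsub>R\<^esub> a)"

definition rr_order :: "('a, 'm) ring_scheme \<Rightarrow> 'a gorder" where
  "rr_order R =
     \<lparr>carrier = carrier R, eq = (=), le = (\<lambda>a b. a \<otimes>\<^bsub>R\<^esub> b = a \<otimes>\<^bsub>R\<^esub> a)\<rparr>"

(* "The infimum of a and b exists in the rr-order and equals c". A relation is used because the
   infimum need not exist in general. *)
definition is_rr_inf :: "('a, 'm) ring_scheme \<Rightarrow> 'a \<Rightarrow> 'a \<Rightarrow> 'a \<Rightarrow> bool" where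
  "is_rr_inf R a b c \<longleftrightarrow> is_glb (rr_order R) c {a, b}"

end

(* An element c with c a = c\<^sup>2 = c b is a lower bound of a and b, and it lies below 0 iff c\<^sup>2 = 0.
   A reduced ring embeds in PMin R because its minimal primes have zero intersection, so lower
   bounds in R map to lower bounds in PMin R and c\<^sup>2 = 0 can be tested there. If a b = 0 in a
   reduced ring, then a R b = 0, so every prime contains a or b; modulo each minimal prime c\<^sup>2 then
   equals c a = 0 or c b = 0. *)
theory Submission
  imports Defs
begin

section \<open>Ideals and primes disjoint from a multiplicative set\<close>

lemma (in ring) ideal_Union_chain:
  assumes "C \<noteq> {}" and "\<And>I. I \<in> C \<Longrightarrow> ideal I R"
    and "\<And>I J. I \<in> C \<Longrightarrow> J \<in> C \<Longrightarrow> I \<subseteq> J \<or> J \<subseteq> I"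
  shows "ideal (\<Union>C) R"
proof (rule idealI)
  show "ring R" by (rule ring_axioms)
  show "subgroup (\<Union>C) (add_monoid R)"
  proof (rule add.subgroupI)
    show "\<Union>C \<subseteq> carrier R" using assms(2) ideal.Icarr by fastforce
    show "\<Union>C \<noteq> {}" using assms(1,2) additive_subgroup.zero_closed ideal.axioms(1) by fastforce
  next
    fix x assume "x \<in> \<Union>C"
    then show "\<ominus> x \<in> \<Union>C"
      using assms(2) additive_subgroup.a_inv_closed ideal.axioms(1) by (metis UnionE UnionI)
  next
    fix x y assume "x \<in> \<Union>C" "y \<in> \<Union>C"
    \<comment> \<open>Comparability puts both summands into one member of the chain; the other
      closure properties hold member by member.\<close>
    then obtain I where "I \<in> C" "x \<in> I" "y \<in> I" using assms(3) by blast
    then show "x \<oplus> y \<in> \<Union>C"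
      using assms(2) additive_subgroup.a_closed ideal.axioms(1) by (metis UnionI)
  qed
next
  fix a x assume "a \<in> \<Union>C" "x \<in> carrier R"
  then show "x \<otimes> a \<in> \<Union>C" "a \<otimes> x \<in> \<Union>C"
    using assms(2) ideal.I_l_closed ideal.I_r_closed by fast+
qed

lemma (in ring) ideal_prod_subset:
  assumes "ideal K R" and "\<And>i j. i \<in> I \<Longrightarrow> j \<in> J \<Longrightarrow> i \<otimes> j \<in> K"
  shows "I \<cdot> J \<subseteq> K"
proof
  interpret K: ideal K R by (rule assms(1))
  fix x assume "x \<in> I \<cdot> J"
  then show "x \<in> K" by induct (simp_all add: assms(2) K.a_closed)
qed

lemma (in ring) subset_set_add:
  assumes "ideal I R" and "ideal J R"
  shows "I \<subseteq> I <+> J" and "J \<subseteq> I <+> J"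
proof -
  have "I \<union> J \<subseteq> carrier R" using assms ideal.Icarr by fast
  \<comment> \<open>\<open>union_genideal\<close> identifies the sum with the ideal generated by the
    union, which contains its generators.\<close>
  then have "I \<union> J \<subseteq> I <+> J"
    using genideal_self union_genideal[OF assms] by metis
  then show "I \<subseteq> I <+> J" and "J \<subseteq> I <+> J" by auto
qed

text \<open>An ideal maximal among those disjoint from \<open>S\<close> is prime.\<close>

lemma (in ring) nc_prime_ideal_disjoint_exists:
  assumes "S \<noteq> {}" and "S \<subseteq> carrier R" and "\<zero> \<notin> S"
    and S_mult: "\<And>s t. s \<in> S \<Longrightarrow> t \<in> S \<Longrightarrow> s \<otimes> t \<in> S"
  obtains P where "nc_prime_ideal P R" and "P \<inter> S = {}"
proof -
  let ?A = "{I. ideal I R \<and> I \<inter> S = {}}"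
  have "\<exists>P\<in>?A. \<forall>X\<in>?A. P \<subseteq> X \<longrightarrow> X = P"
  proof (rule subset_Zorn_nonempty)
    show "?A \<noteq> {}" using zeroideal \<open>\<zero> \<notin> S\<close> by blast
  next
    fix C assume "C \<noteq> {}" and C: "subset.chain ?A C"
    have "C \<subseteq> ?A" using C by (simp add: subset.chain_def)
    moreover have "I \<subseteq> J \<or> J \<subseteq> I" if "I \<in> C" "J \<in> C" for I J
      using C that by (auto simp: subset_chain_def)
    ultimately have "ideal (\<Union>C) R" using ideal_Union_chain[OF \<open>C \<noteq> {}\<close>] by blast
    then show "\<Union>C \<in> ?A" using \<open>C \<subseteq> ?A\<close> by blast
  qed
  then obtain P where "P \<in> ?A" and P_max: "\<forall>X\<in>?A. P \<subseteq> X \<longrightarrow> X = P" by (rule bexE)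
  then have P: "ideal P R" "P \<inter> S = {}" by auto
  have max: "I = P" if "ideal I R" "P \<subseteq> I" "I \<inter> S = {}" for I
    using P_max that by simp
  interpret P: ideal P R by (rule P)
  \<comment> \<open>For \<open>I\<close> not inside \<open>P\<close> the sum \<open>P <+> I\<close>
    is strictly larger than \<open>P\<close>, so by maximality it cannot be disjoint from
    \<open>S\<close>.\<close>
  have meets: "\<exists>p\<in>P. \<exists>i\<in>I. p \<oplus> i \<in> S" if "ideal I R" "\<not> I \<subseteq> P" for I
  proof -
    have "(P <+> I) \<inter> S \<noteq> {}"
      using max[OF add_ideals[OF P(1) that(1)]] subset_set_add[OF P(1) that(1)] that(2) by blast
    then show ?thesis by (auto simp: set_add_defs)
  qed
  have "I \<subseteq> P \<or> J \<subseteq> P" if I: "ideal I R" and J: "ideal J R" and IJ: "I \<cdot> J \<subseteq> P" for I J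
  proof (rule ccontr)
    assume "\<not> (I \<subseteq> P \<or> J \<subseteq> P)"
    then obtain p i q j where pi: "p \<in> P" "i \<in> I" "p \<oplus> i \<in> S" and qj: "q \<in> P" "j \<in> J" "q \<oplus> j \<in> S"
      using meets[OF I] meets[OF J] by blast
    have carr: "p \<in> carrier R" "i \<in> carrier R" "q \<in> carrier R" "j \<in> carrier R"
      using pi qj I J ideal.Icarr P.Icarr by metis+
    have "i \<otimes> j \<in> P" using IJ ideal_prod.prod[OF pi(2) qj(2)] by blast
    \<comment> \<open>These are the terms of (p + i)(q + j). Each of them except i j has a factor in
      \<open>P\<close>, and i j lies in the ideal product. So an element of \<open>S\<close> lands
      in \<open>P\<close>.\<close>
    then have "p \<otimes> (q \<oplus> j) \<oplus> (i \<otimes> q \<oplus> i \<otimes> j) \<in> P"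
      using carr pi(1) qj(1) by (simp add: P.a_closed P.I_l_closed P.I_r_closed)
    moreover have "(p \<oplus> i) \<otimes> (q \<oplus> j) = p \<otimes> (q \<oplus> j) \<oplus> (i \<otimes> q \<oplus> i \<otimes> j)"
      using carr by (simp add: l_distr r_distr[of q j i])
    ultimately show False using S_mult[OF pi(3) qj(3)] P(2) by auto
  qed
  moreover have "P \<noteq> carrier R" using P(2) assms(1,2) by auto
  ultimately have "nc_prime_ideal P R" using P(1) by (simp add: nc_prime_ideal_def)
  then show thesis using P(2) that by blast
qed

section \<open>Minimal primes: existence below a prime, and zero intersection\<close>

lemma (in ring) nc_prime_ideal_Inter_chain:
  assumes "C \<noteq> {}" and prime: "\<And>P. P \<in> C \<Longrightarrow> nc_prime_ideal P R"
    and chain: "\<And>P Q. P \<in> C \<Longrightarrow> Q \<in> C \<Longrightarrow> P \<subseteq> Q \<or> Q \<subseteq> P"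
  shows "nc_prime_ideal (\<Inter>C) R"
  unfolding nc_prime_ideal_def
proof (intro conjI allI impI)
  show "ideal (\<Inter>C) R"
    using assms(1) prime by (intro i_Intersect) (auto simp: nc_prime_ideal_def)
  obtain P where "P \<in> C" using assms(1) by blast
  then have "\<one> \<notin> P" using prime ideal.one_imp_carrier by (auto simp: nc_prime_ideal_def)
  then show "\<Inter>C \<noteq> carrier R" using \<open>P \<in> C\<close> one_closed by blast
next
  fix I J assume I: "ideal I R" and J: "ideal J R" and IJ: "I \<cdot> J \<subseteq> \<Inter>C"
  show "I \<subseteq> \<Inter>C \<or> J \<subseteq> \<Inter>C"
  proof (rule ccontr)
    assume "\<not> (I \<subseteq> \<Inter>C \<or> J \<subseteq> \<Inter>C)"
    then obtain P Q where "P \<in> C" "\<not> I \<subseteq> P" "Q \<in> C" "\<not> J \<subseteq> Q" by blast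
    \<comment> \<open>\<open>K\<close> is the smaller of \<open>P\<close> and \<open>Q\<close>, so
      it contains neither ideal although it contains their product.\<close>
    then obtain K where "K \<in> C" "\<not> I \<subseteq> K" "\<not> J \<subseteq> K" using chain by blast
    moreover have "I \<cdot> J \<subseteq> K" using IJ \<open>K \<in> C\<close> by blast
    ultimately show False using prime I J unfolding nc_prime_ideal_def by blast
  qed
qed

lemma (in ring) Min_primes_below:
  assumes "nc_prime_ideal P R"
  obtains Q where "Q \<in> Min_primes R" and "Q \<subseteq> P"
proof -
  let ?A = "{Q. nc_prime_ideal Q R \<and> Q \<subseteq> P}"
  have "\<exists>Q\<in>?A. \<forall>X\<in>?A. X \<subseteq> Q \<longrightarrow> X = Q"
  \<comment> \<open>Zorn is applied to reversed inclusion, so the bound of a nonempty chain is its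
    intersection. The empty chain is bounded by \<open>P\<close> itself.\<close>
  proof (rule predicate_Zorn)
    show "partial_order_on ?A (relation_of (\<lambda>X Y. Y \<subseteq> X) ?A)"
      by (rule partial_order_on_relation_ofI) auto
  next
    fix C assume C: "C \<in> Chains (relation_of (\<lambda>X Y. Y \<subseteq> X) ?A)"
    then have sub: "C \<subseteq> ?A" by (rule Chains_relation_of)
    show "\<exists>U\<in>?A. \<forall>X\<in>C. U \<subseteq> X"
    proof (cases "C = {}")
      case True
      then show ?thesis using assms by auto
    next
      case False
      moreover have "X \<subseteq> Y \<or> Y \<subseteq> X" if "X \<in> C" "Y \<in> C" for X Y
        using C that unfolding Chains_def relation_of_def by blast
      ultimately have "nc_prime_ideal (\<Inter>C) R"
        using sub by (intro nc_prime_ideal_Inter_chain) auto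
      then show ?thesis using sub False by (intro bexI[of _ "\<Inter>C"]) auto
    qed
  qed
  then obtain Q where "Q \<in> ?A" and "\<forall>X\<in>?A. X \<subseteq> Q \<longrightarrow> X = Q" by (rule bexE)
  \<comment> \<open>A prime inside \<open>Q\<close> is also inside \<open>P\<close>, so minimality
    within \<open>?A\<close> is minimality among all primes.\<close>
  then have "Q \<in> Min_primes R" and "Q \<subseteq> P" by (auto simp: Min_primes_def)
  then show thesis by (rule that)
qed

lemma Min_primes_ideal: "P \<in> Min_primes R \<Longrightarrow> ideal P R"
  by (simp add: Min_primes_def nc_prime_ideal_def)

text \<open>Reducedness keeps zero out of the powers of \<open>x\<close>, so some prime avoids them
  all, and a minimal prime below it still avoids \<open>x\<close>. This is what makes the canonical
  map into the product injective.\<close>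

lemma (in reduced_ring) Min_primes_avoid:
  assumes x: "x \<in> carrier R" and "x \<noteq> \<zero>"
  obtains P where "P \<in> Min_primes R" and "x \<notin> P"
proof -
  let ?S = "range (\<lambda>n::nat. x [^] n)"
  obtain P where P: "nc_prime_ideal P R" "P \<inter> ?S = {}"
  proof (rule nc_prime_ideal_disjoint_exists)
    show "?S \<noteq> {}" by simp
    show "?S \<subseteq> carrier R" using x by auto
    show "\<zero> \<notin> ?S" using reduced[OF x] \<open>x \<noteq> \<zero>\<close> by (metis rangeE)
    show "s \<otimes> t \<in> ?S" if "s \<in> ?S" "t \<in> ?S" for s t
      using that x by (auto simp: nat_pow_mult)
  qed
  have "x [^] (1::nat) \<in> ?S" by (rule rangeI)
  then have "x \<notin> P" using P(2) x by auto
  moreover obtain Q where "Q \<in> Min_primes R" "Q \<subseteq> P" using Min_primes_below[OF P(1)] .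
  ultimately show thesis using that by blast
qed

section \<open>Zero products in a reduced ring and their prime ideals\<close>

lemma (in reduced_ring) mult_middle_zero:
  assumes "a \<in> carrier R" and "b \<in> carrier R" and "r \<in> carrier R" and "a \<otimes> b = \<zero>"
  shows "a \<otimes> r \<otimes> b = \<zero>"
proof -
  have sq: "x = \<zero>" if "x \<in> carrier R" "x \<otimes> x = \<zero>" for x
    using reduced[of x 2] that by (simp add: numeral_2_eq_2)
  \<comment> \<open>Zero products commute: the square of b a contains the factor a b. The same
    device then kills a r b, whose square contains b a.\<close>
  have "(b \<otimes> a) \<otimes> (b \<otimes> a) = b \<otimes> (a \<otimes> b) \<otimes> a" using assms(1-3) by (simp add: m_assoc)
  then have ba: "b \<otimes> a = \<zero>" using assms sq[of "b \<otimes> a"] by simp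
  have "(a \<otimes> r \<otimes> b) \<otimes> (a \<otimes> r \<otimes> b) = a \<otimes> r \<otimes> (b \<otimes> a) \<otimes> r \<otimes> b"
    using assms(1-3) by (simp add: m_assoc)
  then show ?thesis using assms ba sq[of "a \<otimes> r \<otimes> b"] by simp
qed

text \<open>The two ideals below have product zero: \<open>J\<close> is the right annihilator of \<open>a R\<close>, and \<open>I\<close> is
  the left annihilator of \<open>J\<close>.\<close>

lemma (in reduced_ring) nc_prime_ideal_zero_divisors:
  assumes P: "nc_prime_ideal P R" and a: "a \<in> carrier R" and b: "b \<in> carrier R" and ab: "a \<otimes> b = \<zero>"
  shows "a \<in> P \<or> b \<in> P"
proof -
  \<comment> \<open>The middle factor \<open>r\<close> makes \<open>J\<close> closed under left
    multiplication: a multiplier \<open>s\<close> is absorbed by passing from \<open>r\<close> to r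
    s.\<close>
  define J where "J = {y \<in> carrier R. \<forall>r\<in>carrier R. a \<otimes> r \<otimes> y = \<zero>}"
  define I where "I = {x \<in> carrier R. \<forall>y\<in>J. x \<otimes> y = \<zero>}"
  have J_carr: "y \<in> carrier R" if "y \<in> J" for y using that by (simp add: J_def)
  have J: "ideal J R"
  proof (rule idealI)
    show "ring R" by (rule ring_axioms)
    show "subgroup J (add_monoid R)"
      unfolding J_def by (rule add.subgroupI) (auto intro: exI[of _ \<zero>] simp: a r_distr r_minus)
  next
    fix y s assume "y \<in> J" and s: "s \<in> carrier R"
    then have y: "y \<in> carrier R" "\<And>r. r \<in> carrier R \<Longrightarrow> a \<otimes> r \<otimes> y = \<zero>" by (auto simp: J_def)
    have "a \<otimes> r \<otimes> (s \<otimes> y) = \<zero>" if "r \<in> carrier R" for r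
      using y(2)[of "r \<otimes> s"] y(1) s a that by (simp add: m_assoc)
    then show "s \<otimes> y \<in> J" using y s by (simp add: J_def)
    have "a \<otimes> r \<otimes> (y \<otimes> s) = \<zero>" if "r \<in> carrier R" for r
      using y(2)[OF that] y(1) s a that m_assoc[of "a \<otimes> r" y s] by simp
    then show "y \<otimes> s \<in> J" using y s by (simp add: J_def)
  qed
  interpret J: ideal J R by (rule J)
  have I: "ideal I R"
  proof (rule idealI)
    show "ring R" by (rule ring_axioms)
    show "subgroup I (add_monoid R)"
      unfolding I_def
      by (rule add.subgroupI) (auto intro: exI[of _ \<zero>] simp: J_carr l_distr l_minus)
  next
    fix x s assume "x \<in> I" and s: "s \<in> carrier R"
    then have x: "x \<in> carrier R" "\<And>y. y \<in> J \<Longrightarrow> x \<otimes> y = \<zero>" by (auto simp: I_def)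
    then show "s \<otimes> x \<in> I" using s by (auto simp: I_def m_assoc J_carr)
    \<comment> \<open>Here \<open>J\<close> being a left ideal is used: (x s) y = x (s y) with s y
      again in \<open>J\<close>.\<close>
    show "x \<otimes> s \<in> I" using x s J.I_l_closed by (auto simp: I_def m_assoc J_carr)
  qed
  have "ideal P R" using P by (simp add: nc_prime_ideal_def)
  then have "\<zero> \<in> P" using additive_subgroup.zero_closed ideal.axioms(1) by blast
  then have "I \<cdot> J \<subseteq> P" using \<open>ideal P R\<close> by (intro ideal_prod_subset) (auto simp: I_def)
  then have "I \<subseteq> P \<or> J \<subseteq> P" using P I J by (simp add: nc_prime_ideal_def)
  moreover have "b \<in> J"
    unfolding J_def using mult_middle_zero[OF a b _ ab] b by (intro CollectI conjI ballI)
  \<comment> \<open>The case r = 1 in the definition of \<open>J\<close>; it puts \<open>a\<close>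
    into the left annihilator \<open>I\<close>.\<close>
  moreover have "a \<otimes> y = \<zero>" if "y \<in> J" for y
  proof -
    have "\<forall>r\<in>carrier R. a \<otimes> r \<otimes> y = \<zero>"
      using that unfolding J_def by blast
    then have "a \<otimes> \<one> \<otimes> y = \<zero>" by (rule bspec) (rule one_closed)
    then show ?thesis using a by simp
  qed
  then have "a \<in> I" using a by (simp add: I_def)
  ultimately show ?thesis by blast
qed

section \<open>The product of the quotients and the canonical embedding\<close>

lemma ring_product_ring:
  assumes "\<And>i. i \<in> I \<Longrightarrow> ring (S i)"
  shows "ring (product_ring I S)"
proof -
  let ?P = "product_ring I S"
  note rules = ring.ring_simprules[OF assms] monoid.r_one[OF ring.is_monoid[OF assms]]
  have proj: "x i \<in> carrier (S i)" if "x \<in> carrier ?P" "i \<in> I" for x i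
    using that by (auto simp: product_ring_def)
  have ops: "(x \<oplus>\<^bsub>?P\<^esub> y) i = x i \<oplus>\<^bsub>S i\<^esub> y i" "(x \<otimes>\<^bsub>?P\<^esub> y) i = x i \<otimes>\<^bsub>S i\<^esub> y i"
    "\<zero>\<^bsub>?P\<^esub> i = \<zero>\<^bsub>S i\<^esub>" "\<one>\<^bsub>?P\<^esub> i = \<one>\<^bsub>S i\<^esub>" if "i \<in> I" for x y i
    using that by (simp_all add: product_ring_def)
  have closed: "x \<oplus>\<^bsub>?P\<^esub> y \<in> carrier ?P" "x \<otimes>\<^bsub>?P\<^esub> y \<in> carrier ?P"
    if "x \<in> carrier ?P" "y \<in> carrier ?P" for x y
    using proj[OF that(1)] proj[OF that(2)] by (auto simp: product_ring_def rules(1,5))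
  have unit_closed: "\<zero>\<^bsub>?P\<^esub> \<in> carrier ?P" "\<one>\<^bsub>?P\<^esub> \<in> carrier ?P"
    by (auto simp: product_ring_def rules(2,6))
  \<comment> \<open>Elements are extensional functions, so agreement on \<open>I\<close> is
    equality; this reduces every ring axiom to the factors.\<close>
  have eqI: "x = y" if "x \<in> carrier ?P" "y \<in> carrier ?P" "\<And>i. i \<in> I \<Longrightarrow> x i = y i" for x y
    using that by (auto simp: product_ring_def intro: PiE_ext)
  show ?thesis
  proof (intro ringI abelian_groupI monoidI)
    fix x assume x: "x \<in> carrier ?P"
    show "\<exists>y\<in>carrier ?P. y \<oplus>\<^bsub>?P\<^esub> x = \<zero>\<^bsub>?P\<^esub>"
    proof
      show inv: "(\<lambda>i\<in>I. \<ominus>\<^bsub>S i\<^esub> x i) \<in> carrier ?P"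
        using proj[OF x] by (auto simp: product_ring_def rules(3))
      show "(\<lambda>i\<in>I. \<ominus>\<^bsub>S i\<^esub> x i) \<oplus>\<^bsub>?P\<^esub> x = \<zero>\<^bsub>?P\<^esub>"
        by (rule eqI) (simp_all add: closed unit_closed inv x ops proj rules(9))
    qed
  next
    fix x y assume "x \<in> carrier ?P" "y \<in> carrier ?P"
    then show "x \<oplus>\<^bsub>?P\<^esub> y = y \<oplus>\<^bsub>?P\<^esub> x"
      by (intro eqI) (simp_all add: closed ops proj rules(10))
  qed (auto intro!: eqI simp: closed unit_closed ops proj rules(1,2,5-8,11-13,23,28))
qed

lemma ring_PMin: "ring (PMin R)"
  unfolding PMin_def by (intro ring_product_ring ideal.quotient_is_ring Min_primes_ideal)

lemma PMin_embed_closed: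
  "x \<in> carrier R \<Longrightarrow> PMin_embed R x \<in> carrier (PMin R)"
  using ring_hom_closed[OF ideal.rcos_ring_hom[OF Min_primes_ideal]]
  by (auto simp: PMin_embed_def PMin_def product_ring_def)

lemma PMin_embed_mult:
  assumes "x \<in> carrier R" and "y \<in> carrier R"
  shows "PMin_embed R x \<otimes>\<^bsub>PMin R\<^esub> PMin_embed R y = PMin_embed R (x \<otimes>\<^bsub>R\<^esub> y)"
  using ring_hom_mult[OF ideal.rcos_ring_hom[OF Min_primes_ideal] assms]
  by (auto simp: PMin_embed_def PMin_def product_ring_def intro!: restrict_ext)

lemma (in ring) rcos_eq_ideal_iff:
  assumes "ideal P R" and "x \<in> carrier R"
  shows "P +> x = P \<longleftrightarrow> x \<in> P"
  using assms ideal.axioms(1) additive_subgroup.a_subgroup a_coset_join1 a_coset_join2 by blast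

text \<open>The coordinate at \<open>P\<close> is zero exactly when \<open>x\<close> lies in
  \<open>P\<close>, and a nonzero \<open>x\<close> is missed by some minimal prime.\<close>

lemma (in reduced_ring) PMin_embed_eq_zero:
  assumes "x \<in> carrier R" and "PMin_embed R x = \<zero>\<^bsub>PMin R\<^esub>"
  shows "x = \<zero>"
proof (rule ccontr)
  assume "x \<noteq> \<zero>"
  then obtain P where P: "P \<in> Min_primes R" "x \<notin> P" using Min_primes_avoid assms(1) by blast
  have "P +> x = P"
    using fun_cong[OF assms(2), of P] P(1)
    by (simp add: PMin_embed_def PMin_def product_ring_def FactRing_def)
  then show False using rcos_eq_ideal_iff[OF Min_primes_ideal[OF P(1)] assms(1)] P(2) by blast
qed

section \<open>Infimum zero in the rr-order\<close>

lemma (in ring) is_rr_inf_zero_iff: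
  assumes "a \<in> carrier R" and "b \<in> carrier R"
  shows "is_rr_inf R a b \<zero> \<longleftrightarrow>
    (\<forall>c\<in>carrier R. c \<otimes> a = c \<otimes> c \<longrightarrow> c \<otimes> b = c \<otimes> c \<longrightarrow> c \<otimes> c = \<zero>)"
proof -
  \<comment> \<open>Zero is always one of these lower bounds, so it is the greatest iff every
    \<open>c\<close> among them satisfies c c = c 0 = 0. With this condition in place of c = 0, the
    criterion holds in any ring, so \<open>ring_PMin\<close> suffices to use it in the
    product.\<close>
  have "Lower (rr_order R) {a, b} = {c \<in> carrier R. c \<otimes> a = c \<otimes> c \<and> c \<otimes> b = c \<otimes> c}"
    using assms by (auto simp: Lower_def rr_order_def)
  then show ?thesis using assms by (auto simp: is_rr_inf_def greatest_def rr_order_def)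
qed

lemma (in reduced_ring) is_rr_inf_PMin_imp:
  assumes a: "a \<in> carrier R" and b: "b \<in> carrier R"
    and inf: "is_rr_inf (PMin R) (PMin_embed R a) (PMin_embed R b) \<zero>\<^bsub>PMin R\<^esub>"
  shows "is_rr_inf R a b \<zero>"
proof -
  have "c \<otimes> c = \<zero>" if c: "c \<in> carrier R" "c \<otimes> a = c \<otimes> c" "c \<otimes> b = c \<otimes> c" for c
  proof -
    note iff = ring.is_rr_inf_zero_iff[OF ring_PMin PMin_embed_closed[OF a] PMin_embed_closed[OF b]]
    \<comment> \<open>The embedding is multiplicative, so the image of \<open>c\<close> is a lower
      bound of the images of \<open>a\<close> and \<open>b\<close>. Injectivity brings the vanishing
      square back to \<open>R\<close>.\<close>
    from bspec[OF inf[unfolded iff] PMin_embed_closed[OF c(1)]]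
    have "PMin_embed R (c \<otimes> c) = \<zero>\<^bsub>PMin R\<^esub>"
      using c a b by (simp add: PMin_embed_mult)
    then show ?thesis using PMin_embed_eq_zero c(1) by simp
  qed
  then show ?thesis using is_rr_inf_zero_iff[OF a b] by blast
qed

lemma (in reduced_ring) is_rr_inf_PMin_zero:
  assumes a: "a \<in> carrier R" and b: "b \<in> carrier R" and ab: "a \<otimes> b = \<zero>"
  shows "is_rr_inf (PMin R) (PMin_embed R a) (PMin_embed R b) \<zero>\<^bsub>PMin R\<^esub>"
proof -
  have "c \<otimes>\<^bsub>PMin R\<^esub> c = \<zero>\<^bsub>PMin R\<^esub>"
    if c: "c \<in> carrier (PMin R)"
      and ca: "c \<otimes>\<^bsub>PMin R\<^esub> PMin_embed R a = c \<otimes>\<^bsub>PMin R\<^esub> c"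
      and cb: "c \<otimes>\<^bsub>PMin R\<^esub> PMin_embed R b = c \<otimes>\<^bsub>PMin R\<^esub> c" for c
  proof -
    \<comment> \<open>Here \<open>c\<close> is an arbitrary element of the product, possibly outside
      the image of \<open>R\<close>, so the argument runs in each quotient: one of \<open>a\<close>,
      \<open>b\<close> becomes zero there, and the square of \<open>c P\<close> equals
      \<open>c P\<close> times that zero.\<close>
    have "c P \<otimes>\<^bsub>R Quot P\<^esub> c P = \<zero>\<^bsub>R Quot P\<^esub>" if P: "P \<in> Min_primes R" for P
    proof -
      have id: "ideal P R" using P by (rule Min_primes_ideal)
      interpret Q: ring "R Quot P" using id by (rule ideal.quotient_is_ring)
      have zero: "P +> x = \<zero>\<^bsub>R Quot P\<^esub>" if "x \<in> P" for x
        using that rcos_eq_ideal_iff[OF id] ideal.Icarr[OF id] by (simp add: FactRing_def)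
      have "c P \<in> carrier (R Quot P)" using c P by (auto simp: PMin_def product_ring_def)
      moreover have "c P \<otimes>\<^bsub>R Quot P\<^esub> (P +> a) = c P \<otimes>\<^bsub>R Quot P\<^esub> c P"
        and "c P \<otimes>\<^bsub>R Quot P\<^esub> (P +> b) = c P \<otimes>\<^bsub>R Quot P\<^esub> c P"
        using fun_cong[OF ca, of P] fun_cong[OF cb, of P] P
        by (simp_all add: PMin_def product_ring_def PMin_embed_def)
      moreover have "a \<in> P \<or> b \<in> P"
        using nc_prime_ideal_zero_divisors[OF _ a b ab] P by (simp add: Min_primes_def)
      ultimately show ?thesis using zero Q.r_null by metis
    qed
    then show ?thesis by (auto simp: PMin_def product_ring_def intro!: restrict_ext)
  qed
  then show ?thesis
    unfolding ring.is_rr_inf_zero_iff[OF ring_PMin PMin_embed_closed[OF a] PMin_embed_closed[OF b]]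
    by (intro ballI impI)
qed

theorem corollary2p2:
  fixes R :: "('a, 'm) ring_scheme"
  assumes "reduced_ring R"
    and "a \<in> carrier R" and "b \<in> carrier R"
  shows "(is_rr_inf (PMin R) (PMin_embed R a) (PMin_embed R b) \<zero>\<^bsub>PMin R\<^esub> \<longrightarrow>
            is_rr_inf R a b \<zero>\<^bsub>R\<^esub>) \<and>
         (a \<otimes>\<^bsub>R\<^esub> b = \<zero>\<^bsub>R\<^esub> \<longrightarrow>
            is_rr_inf (PMin R) (PMin_embed R a) (PMin_embed R b) \<zero>\<^bsub>PMin R\<^esub> \<and>
            is_rr_inf R a b \<zero>\<^bsub>R\<^esub>)"
  \<comment> \<open>When a b = 0, the infimum in \<open>R\<close> comes from the one in the product
    by the first implication.\<close>
  using reduced_ring.is_rr_inf_PMin_imp[OF assms] reduced_ring.is_rr_inf_PMin_zero[OF assms]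
  by blast

end
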